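(* Let $(L,\circ,\curlyvee)$ be an NS-Lie algebra. Define, for all $x,y,z\in L$, $$\{x,y,z\}=z\circ(y\circ x),\qquad [x,y,z]=(x\ast y)\curlyvee z-z\circ(x\curlyvee y),$$ where $x\ast y=x\circ y-y\circ x+x\curlyvee y$. Then $(L,\{\cdot,\cdot,\cdot\},[\cdot,\cdot,\cdot])$ is an NS-Lie triple system. Moreover, $[\![x,y,z]\!]=(x\ast y)\ast z$, where $[\![x,y,z]\!]=\{x,y,z\}^\ast+\{x,y,z\}-\{y,x,z\}+[x,y,z]$ and $\{x,y,z\}^\ast=\{z,y,x\}-\{z,x,y\}$.
   Context: All vector spaces are over a field $\mathbb K$ of characteristic $0$. An NS-Lie algebra is a vector space $L$ with bilinear operations $\circ,\curlyvee:L\times L\to L$, with $\curlyvee$ skew-symmetric, such that with $x\ast y=x\circ y-y\circ x+x\curlyvee y$, for all $x,y,z\in L$: $(x\ast y)\circ z-x\circ(y\circ z)+y\circ(x\circ z)=0$ and $x\curlyvee(y\ast z)+y\curlyvee(z\ast x)+z\curlyvee(x\ast y)+x\circ(y\curlyvee z)+y\circ(z\curlyvee x)+z\circ(x\curlyvee y)=0$. An NS-Lie triple system is a vector space $A$ with two trilinear maps $\{\cdot,\cdot,\cdot\},[\cdot,\cdot,\cdot]:A^3\to A$ such that, writing $\{y_1,y_2,y_3\}^\ast=\{y_3,y_2,y_1\}-\{y_3,y_1,y_2\}$ and $[\![y_1,y_2,y_3]\!]=\{y_1,y_2,y_3\}^\ast+\{y_1,y_2,y_3\}-\{y_2,y_1,y_3\}+[y_1,y_2,y_3]$,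 for all $x_1,x_2,y_1,y_2,y_3\in A$: (1) $[y_1,y_2,y_3]=-[y_2,y_1,y_3]$ and $[y_1,y_2,y_3]+[y_2,y_3,y_1]+[y_3,y_1,y_2]=0$; (2) $\{x_1,x_2,[\![y_1,y_2,y_3]\!]\}=\{\{x_1,x_2,y_1\},y_2,y_3\}-\{\{x_1,x_2,y_2\},y_1,y_3\}+\{y_1,y_2,\{x_1,x_2,y_3\}\}^\ast$; (3) $\{x_1,x_2,\{y_1,y_2,y_3\}\}^\ast=\{\{x_1,x_2,y_1\}^\ast,y_2,y_3\}+\{y_1,[\![x_1,x_2,y_2]\!],y_3\}+\{y_1,y_2,[\![x_1,x_2,y_3]\!]\}$; (4) $[x_1,x_2,[\![y_1,y_2,y_3]\!]]=[[\![x_1,x_2,y_1]\!],y_2,y_3]+[y_1,[\![x_1,x_2,y_2]\!],y_3]+[y_1,y_2,[\![x_1,x_2,y_3]\!]]+\{[x_1,x_2,y_1],y_2,y_3\}-\{[x_1,x_2,y_2],y_1,y_3\}+\{y_1,y_2,[x_1,x_2,y_3]\}^\ast-\{x_1,x_2,[y_1,y_2,y_3]\}^\ast$. *)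

theory Defs
  imports Complex_Main
begin

definition bilinear_op :: "('k::field \<Rightarrow> 'a::ab_group_add \<Rightarrow> 'a) \<Rightarrow> ('a \<Rightarrow> 'a \<Rightarrow> 'a) \<Rightarrow> bool" where
  "bilinear_op scale f \<longleftrightarrow>
     (\<forall>y. Vector_Spaces.linear scale scale (\<lambda>x. f x y)) \<and>
     (\<forall>x. Vector_Spaces.linear scale scale (\<lambda>y. f x y))"

definition trilinear_op :: "('k::field \<Rightarrow> 'a::ab_group_add \<Rightarrow> 'a) \<Rightarrow> ('a \<Rightarrow> 'a \<Rightarrow> 'a \<Rightarrow> 'a) \<Rightarrow> bool" where
  "trilinear_op scale f \<longleftrightarrow>
     (\<forall>y z. Vector_Spaces.linear scale scale (\<lambda>x. f x y z)) \<and>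
     (\<forall>x z. Vector_Spaces.linear scale scale (\<lambda>y. f x y z)) \<and>
     (\<forall>x y. Vector_Spaces.linear scale scale (\<lambda>z. f x y z))"

text \<open>The operation \<open>x \<ast> y = x \<circ> y - y \<circ> x + x \<curlyvee> y\<close>, with \<open>circ\<close> for \<open>\<circ>\<close> and
  \<open>cv\<close> for \<open>\<curlyvee>\<close>.\<close>

definition ns_ast :: "('a::ab_group_add \<Rightarrow> 'a \<Rightarrow> 'a) \<Rightarrow> ('a \<Rightarrow> 'a \<Rightarrow> 'a) \<Rightarrow> 'a \<Rightarrow> 'a \<Rightarrow> 'a" where
  "ns_ast circ cv x y = circ x y - circ y x + cv x y"

locale ns_lie_algebra = vector_space scale
  for scale :: "'k::field_char_0 \<Rightarrow> 'a::ab_group_add \<Rightarrow> 'a" +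
  fixes circ :: "'a \<Rightarrow> 'a \<Rightarrow> 'a" (infixl "\<odot>" 70)
    and cv :: "'a \<Rightarrow> 'a \<Rightarrow> 'a" (infixl "\<curlyvee>" 70)
  assumes circ_bilinear: "bilinear_op scale circ"
    and cv_bilinear: "bilinear_op scale cv"
    and cv_skew: "x \<curlyvee> y = - (y \<curlyvee> x)"
    and circ_ast: "ns_ast circ cv x y \<odot> z - x \<odot> (y \<odot> z) + y \<odot> (x \<odot> z) = 0"
    and cv_ast:
      "x \<curlyvee> ns_ast circ cv y z + y \<curlyvee> ns_ast circ cv z x + z \<curlyvee> ns_ast circ cv x y
        + x \<odot> (y \<curlyvee> z) + y \<odot> (z \<curlyvee> x) + z \<odot> (x \<curlyvee> y) = 0"

text \<open>For the two ternary operations, \<open>T x y z\<close> stands for \<open>{x, y, z}\<close> and \<open>B x y z\<close> for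
  \<open>[x, y, z]\<close>; then \<open>triple_star T x y z\<close> is \<open>{x, y, z}\<^sup>*\<close> and \<open>triple_dbl T B x y z\<close> is
  \<open>\<lbrakk>x, y, z\<rbrakk>\<close>.\<close>

definition triple_star :: "('a::ab_group_add \<Rightarrow> 'a \<Rightarrow> 'a \<Rightarrow> 'a) \<Rightarrow> 'a \<Rightarrow> 'a \<Rightarrow> 'a \<Rightarrow> 'a" where
  "triple_star T x y z = T z y x - T z x y"

definition triple_dbl ::
    "('a::ab_group_add \<Rightarrow> 'a \<Rightarrow> 'a \<Rightarrow> 'a) \<Rightarrow> ('a \<Rightarrow> 'a \<Rightarrow> 'a \<Rightarrow> 'a) \<Rightarrow> 'a \<Rightarrow> 'a \<Rightarrow> 'a \<Rightarrow> 'a" where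
  "triple_dbl T B x y z = triple_star T x y z + T x y z - T y x z + B x y z"

locale ns_lie_triple_system = vector_space scale
  for scale :: "'k::field_char_0 \<Rightarrow> 'a::ab_group_add \<Rightarrow> 'a" +
  fixes T :: "'a \<Rightarrow> 'a \<Rightarrow> 'a \<Rightarrow> 'a"
    and B :: "'a \<Rightarrow> 'a \<Rightarrow> 'a \<Rightarrow> 'a"
  assumes T_trilinear: "trilinear_op scale T"
    and B_trilinear: "trilinear_op scale B"
    and B_skew: "B y1 y2 y3 = - B y2 y1 y3"
    and B_cyclic: "B y1 y2 y3 + B y2 y3 y1 + B y3 y1 y2 = 0"
    and T_dbl:
      "T x1 x2 (triple_dbl T B y1 y2 y3)
        = T (T x1 x2 y1) y2 y3 - T (T x1 x2 y2) y1 y3 + triple_star T y1 y2 (T x1 x2 y3)"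
    and star_T:
      "triple_star T x1 x2 (T y1 y2 y3)
        = T (triple_star T x1 x2 y1) y2 y3 + T y1 (triple_dbl T B x1 x2 y2) y3
          + T y1 y2 (triple_dbl T B x1 x2 y3)"
    and B_dbl:
      "B x1 x2 (triple_dbl T B y1 y2 y3)
        = B (triple_dbl T B x1 x2 y1) y2 y3 + B y1 (triple_dbl T B x1 x2 y2) y3
          + B y1 y2 (triple_dbl T B x1 x2 y3)
          + T (B x1 x2 y1) y2 y3 - T (B x1 x2 y2) y1 y3
          + triple_star T y1 y2 (B x1 x2 y3) - triple_star T x1 x2 (B y1 y2 y3)"

end

theory Submission imports Defs begin

text \<open>
  The product \<open>x \<star> y = x \<circ> y - y \<circ> x + x \<curlyvee> y\<close> of an NS-Lie algebra is a Lie bracket, and the first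
  axiom says that \<open>L\<^sub>x = x \<circ> _\<close> represents it: \<open>L\<^bsub>x\<star>y\<^esub> = [L\<^sub>x, L\<^sub>y]\<close>. Three observations drive
  the proof.

  First, \<open>{x, y, z}\<^sup>* = L\<^sub>x L\<^sub>y z - L\<^sub>y L\<^sub>x z = (x \<star> y) \<circ> z\<close>, from which
  \<open>\<lbrakk>x, y, z\<rbrakk> = (x \<star> y) \<star> z\<close> drops out: the double bracket is the Lie triple product of the Lie
  bracket. Once the starred and double brackets are rewritten this way, the two identities for
  \<open>{x\<^sub>1, x\<^sub>2, \<lbrakk>y\<^sub>1, y\<^sub>2, y\<^sub>3\<rbrakk>}\<close> and \<open>{x\<^sub>1, x\<^sub>2, {y\<^sub>1, y\<^sub>2, y\<^sub>3}}\<^sup>*\<close> are statements about iterated operators \<open>L\<close>,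
  and follow from \<open>L\<^bsub>x\<star>y\<^esub> = [L\<^sub>x, L\<^sub>y]\<close> alone.

  Second, the second NS-Lie axiom says that \<open>\<curlyvee>\<close> is a cocycle for this representation. Up to signs
  it is the cyclic identity of \<open>[_, _, _]\<close>, and solving it for its first term gives a rule for
  pushing an element \<open>a\<close> into a product \<open>y \<star> z\<close> (\<open>cv_ast_right\<close>).

  Third, the identity for \<open>[x\<^sub>1, x\<^sub>2, \<lbrakk>y\<^sub>1, y\<^sub>2, y\<^sub>3\<rbrakk>]\<close> is that rule applied twice.
  Write \<open>a = x\<^sub>1 \<star> x\<^sub>2\<close> and \<open>b = y\<^sub>1 \<star> y\<^sub>2\<close>. The
  leading term \<open>a \<curlyvee> (b \<star> y\<^sub>3)\<close> is expanded by the rule, which leaves a term \<open>y\<^sub>3 \<circ> (a \<curlyvee> b)\<close>; the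
  rule expands that again, because \<open>b\<close> is itself a product. What remains is matched by the Jacobi
  identity and the representation property.
\<close>

section \<open>The Lie bracket of an NS-Lie algebra\<close>

context ns_lie_algebra
begin

abbreviation ast :: "'a \<Rightarrow> 'a \<Rightarrow> 'a" (infixl "\<star>" 70) where
  "x \<star> y \<equiv> ns_ast (\<odot>) (\<curlyvee>) x y"

lemma circ_linear:
  "Vector_Spaces.linear scale scale (\<lambda>x. x \<odot> y)"
  "Vector_Spaces.linear scale scale (\<lambda>y. x \<odot> y)"
  using circ_bilinear by (auto simp: bilinear_op_def)

lemma cv_linear:
  "Vector_Spaces.linear scale scale (\<lambda>x. x \<curlyvee> y)"
  "Vector_Spaces.linear scale scale (\<lambda>y. x \<curlyvee> y)"
  using cv_bilinear by (auto simp: bilinear_op_def)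

lemma circ_additive:
  "(x + y) \<odot> z = x \<odot> z + y \<odot> z"
  "z \<odot> (x + y) = z \<odot> x + z \<odot> y"
  "(x - y) \<odot> z = x \<odot> z - y \<odot> z"
  "z \<odot> (x - y) = z \<odot> x - z \<odot> y"
  "z \<odot> (- x) = - (z \<odot> x)"
  using circ_linear[unfolded linear_iff_module_hom, THEN module_hom.add]
    circ_linear[unfolded linear_iff_module_hom, THEN module_hom.diff]
    circ_linear(2)[unfolded linear_iff_module_hom, THEN module_hom.neg]
  by simp_all

lemma cv_additive:
  "(x + y) \<curlyvee> z = x \<curlyvee> z + y \<curlyvee> z"
  "z \<curlyvee> (- x) = - (z \<curlyvee> x)"
  using cv_linear(1)[unfolded linear_iff_module_hom, THEN module_hom.add]
    cv_linear(2)[unfolded linear_iff_module_hom, THEN module_hom.neg]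
  by simp_all

lemma ast_linear:
  "Vector_Spaces.linear scale scale (\<lambda>x. x \<star> y)"
  "Vector_Spaces.linear scale scale (\<lambda>y. x \<star> y)"
proof -
  interpret vector_space_pair scale scale ..
  show "Vector_Spaces.linear scale scale (\<lambda>x. x \<star> y)"
    and "Vector_Spaces.linear scale scale (\<lambda>y. x \<star> y)"
    unfolding ns_ast_def
    by (intro linear_compose_add linear_compose_sub circ_linear cv_linear)+
qed

lemma ast_skew: "x \<star> y = - (y \<star> x)"
  using cv_skew[of x y] by (simp add: ns_ast_def)

lemma circ_ast_left: "(x \<star> y) \<odot> z = x \<odot> (y \<odot> z) - y \<odot> (x \<odot> z)"
  using circ_ast[of x y z] by (simp add: algebra_simps)

text \<open>The cyclic axiom in the form in which it is used: the first two summands on the right have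
  the shape of a derivation rule for \<open>a\<close>, and the three terms in \<open>\<odot>\<close> are the correction by the
  representation.\<close>

lemma cv_ast_right:
  "a \<curlyvee> (y \<star> z) = (a \<star> y) \<curlyvee> z + y \<curlyvee> (a \<star> z) - a \<odot> (y \<curlyvee> z) + y \<odot> (a \<curlyvee> z) - z \<odot> (a \<curlyvee> y)"
proof -
  have "y \<curlyvee> (z \<star> a) = - (y \<curlyvee> (a \<star> z))"
    using ast_skew[of z a] by (simp add: cv_additive)
  moreover have "z \<curlyvee> (a \<star> y) = - ((a \<star> y) \<curlyvee> z)"
    by (rule cv_skew)
  moreover have "y \<odot> (z \<curlyvee> a) = - (y \<odot> (a \<curlyvee> z))"
    using cv_skew[of z a] by (simp add: circ_additive)
  ultimately show ?thesis
    using cv_ast[of a y z] by (simp add: algebra_simps)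
qed

text \<open>The part of the Jacobi identity without \<open>\<curlyvee>\<close> follows from the representation property, and
  the part with it is the cocycle rule.\<close>

lemma ast_derivation: "a \<star> (y \<star> z) = (a \<star> y) \<star> z + y \<star> (a \<star> z)"
proof -
  have circ_right: "u \<odot> (v \<star> w) = u \<odot> (v \<odot> w) - u \<odot> (w \<odot> v) + u \<odot> (v \<curlyvee> w)" for u v w
    by (simp add: ns_ast_def circ_additive)
  have unfold: "u \<star> v = u \<odot> v - v \<odot> u + u \<curlyvee> v" for u v
    by (rule ns_ast_def)
  show ?thesis
    by (simp add: unfold[of a "y \<star> z"] unfold[of "a \<star> y" z] unfold[of y "a \<star> z"]
        circ_right circ_ast_left cv_ast_right[of a y z] algebra_simps)
qed

section \<open>The induced ternary operations\<close>

definition triple :: "'a \<Rightarrow> 'a \<Rightarrow> 'a \<Rightarrow> 'a" where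
  "triple x y z = z \<odot> (y \<odot> x)"

definition bracket :: "'a \<Rightarrow> 'a \<Rightarrow> 'a \<Rightarrow> 'a" where
  "bracket x y z = (x \<star> y) \<curlyvee> z - z \<odot> (x \<curlyvee> y)"

lemma triple_star_triple: "triple_star triple x y z = (x \<star> y) \<odot> z"
  by (simp add: triple_star_def triple_def circ_ast_left)

lemma triple_dbl_triple_bracket: "triple_dbl triple bracket x y z = (x \<star> y) \<star> z"
proof -
  have "z \<odot> (x \<star> y) = z \<odot> (x \<odot> y) - z \<odot> (y \<odot> x) + z \<odot> (x \<curlyvee> y)"
    by (simp add: ns_ast_def circ_additive)
  moreover have "(x \<star> y) \<star> z = (x \<star> y) \<odot> z - z \<odot> (x \<star> y) + (x \<star> y) \<curlyvee> z"
    by (rule ns_ast_def)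
  ultimately show ?thesis
    by (simp add: triple_dbl_def triple_star_triple triple_def bracket_def)
qed

lemma triple_trilinear: "trilinear_op scale triple"
  unfolding trilinear_op_def triple_def
  using Vector_Spaces.linear_compose[OF circ_linear(2) circ_linear(2)]
    Vector_Spaces.linear_compose[OF circ_linear(1) circ_linear(2)] circ_linear(1)
  by (simp add: o_def)

lemma bracket_trilinear: "trilinear_op scale bracket"
proof -
  interpret vector_space_pair scale scale ..
  have "Vector_Spaces.linear scale scale (\<lambda>x. bracket x y z)" for y z
    unfolding bracket_def
    using linear_compose_sub[OF Vector_Spaces.linear_compose[OF ast_linear(1) cv_linear(1)]
        Vector_Spaces.linear_compose[OF cv_linear(1) circ_linear(2)]]
    by (simp add: o_def)
  moreover have "Vector_Spaces.linear scale scale (\<lambda>y. bracket x y z)" for x z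
    unfolding bracket_def
    using linear_compose_sub[OF Vector_Spaces.linear_compose[OF ast_linear(2) cv_linear(1)]
        Vector_Spaces.linear_compose[OF cv_linear(2) circ_linear(2)]]
    by (simp add: o_def)
  moreover have "Vector_Spaces.linear scale scale (\<lambda>z. bracket x y z)" for x y
    unfolding bracket_def
    by (rule linear_compose_sub[OF cv_linear(2) circ_linear(1)])
  ultimately show ?thesis
    by (simp add: trilinear_op_def)
qed

lemma bracket_skew: "bracket x y z = - bracket y x z"
proof -
  have "(x \<star> y) \<curlyvee> z = - ((y \<star> x) \<curlyvee> z)"
    using cv_skew[of "x \<star> y" z] cv_skew[of "y \<star> x" z] ast_skew[of x y] by (simp add: cv_additive)
  moreover have "z \<odot> (x \<curlyvee> y) = - (z \<odot> (y \<curlyvee> x))"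
    using cv_skew[of x y] by (simp add: circ_additive)
  ultimately show ?thesis
    by (simp add: bracket_def)
qed

text \<open>By skew-symmetry \<open>bracket x y z = - (z \<curlyvee> (x \<star> y) + z \<odot> (x \<curlyvee> y))\<close>, so the cyclic sum is minus
  the left-hand side of the second NS-Lie axiom.\<close>

lemma bracket_cyclic: "bracket x y z + bracket y z x + bracket z x y = 0"
proof -
  have bracket_eq: "bracket u v w = - (w \<curlyvee> (u \<star> v) + w \<odot> (u \<curlyvee> v))" for u v w
    using cv_skew[of "u \<star> v" w] by (simp add: bracket_def)
  have "bracket x y z + bracket y z x + bracket z x y
    = - (x \<curlyvee> (y \<star> z) + y \<curlyvee> (z \<star> x) + z \<curlyvee> (x \<star> y)
        + x \<odot> (y \<curlyvee> z) + y \<odot> (z \<curlyvee> x) + z \<odot> (x \<curlyvee> y))"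
    by (simp add: bracket_eq algebra_simps)
  then show ?thesis
    by (simp add: cv_ast)
qed

lemma triple_Lie_triple_product:
  "triple x1 x2 ((y1 \<star> y2) \<star> y3)
    = triple (triple x1 x2 y1) y2 y3 - triple (triple x1 x2 y2) y1 y3
      + (y1 \<star> y2) \<odot> triple x1 x2 y3"
  by (simp add: triple_def circ_ast_left circ_additive algebra_simps)

text \<open>Each \<open>L\<^sub>a\<close> is compatible with \<open>triple\<close>: moving \<open>a\<close> past the operators \<open>L\<close> of the last two
  arguments costs the commutators \<open>L\<^bsub>a\<star>y\<^esub>\<close>. For \<open>a = x1 \<star> x2\<close> the left-hand side is
  \<open>{x1, x2, {y1, y2, y3}}\<^sup>*\<close>.\<close>

lemma circ_triple:
  "a \<odot> triple y1 y2 y3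
    = triple (a \<odot> y1) y2 y3 + triple y1 (a \<star> y2) y3 + triple y1 y2 (a \<star> y3)"
  by (simp add: triple_def circ_ast_left circ_additive algebra_simps)

text \<open>Two applications of the cocycle rule, the second nested in the first: \<open>outer\<close> pushes \<open>a\<close> into
  \<open>b \<star> y3\<close>, and \<open>nested\<close> pushes it further into \<open>b = y1 \<star> y2\<close>. The Jacobi identity collects the two
  brackets in which \<open>a\<close> has reached \<open>y1\<close> or \<open>y2\<close>, and the terms with \<open>x1 \<curlyvee> x2\<close> or \<open>y1 \<curlyvee> y2\<close> are
  matched by the representation property.\<close>

lemma bracket_Lie_triple_product:
  "bracket x1 x2 ((y1 \<star> y2) \<star> y3)
    = bracket ((x1 \<star> x2) \<star> y1) y2 y3 + bracket y1 ((x1 \<star> x2) \<star> y2) y3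
      + bracket y1 y2 ((x1 \<star> x2) \<star> y3)
      + triple (bracket x1 x2 y1) y2 y3 - triple (bracket x1 x2 y2) y1 y3
      + (y1 \<star> y2) \<odot> bracket x1 x2 y3 - (x1 \<star> x2) \<odot> bracket y1 y2 y3"
proof -
  define a where "a = x1 \<star> x2"
  define b where "b = y1 \<star> y2"
  define c where "c = x1 \<curlyvee> x2"
  define d where "d = y1 \<curlyvee> y2"
  have bracket_x: "bracket x1 x2 w = a \<curlyvee> w - w \<odot> c" for w
    by (simp add: bracket_def a_def c_def)
  have bracket_y: "bracket y1 y2 w = b \<curlyvee> w - w \<odot> d" for w
    by (simp add: bracket_def b_def d_def)
  have inner: "bracket (a \<star> y1) y2 y3 + bracket y1 (a \<star> y2) y3
      = (a \<star> b) \<curlyvee> y3 - y3 \<odot> ((a \<star> y1) \<curlyvee> y2 + y1 \<curlyvee> (a \<star> y2))"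
    using ast_derivation[of a y1 y2]
    by (simp add: bracket_def b_def cv_additive circ_additive algebra_simps)
  have outer: "a \<curlyvee> (b \<star> y3)
      = (a \<star> b) \<curlyvee> y3 + b \<curlyvee> (a \<star> y3) - a \<odot> (b \<curlyvee> y3) + b \<odot> (a \<curlyvee> y3) - y3 \<odot> (a \<curlyvee> b)"
    by (rule cv_ast_right)
  have nested: "y3 \<odot> (a \<curlyvee> b)
      = y3 \<odot> ((a \<star> y1) \<curlyvee> y2 + y1 \<curlyvee> (a \<star> y2)) - y3 \<odot> (a \<odot> d)
        + y3 \<odot> (y1 \<odot> (a \<curlyvee> y2)) - y3 \<odot> (y2 \<odot> (a \<curlyvee> y1))"
    by (simp add: b_def d_def cv_ast_right[of a y1 y2] circ_additive)
  \<comment> \<open>The terms containing \<open>c\<close> form the commutator of the operators of \<open>y1\<close> and \<open>y2\<close>, hence \<open>b \<odot> c\<close>.\<close>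
  have triples: "triple (bracket x1 x2 y1) y2 y3 - triple (bracket x1 x2 y2) y1 y3
      = y3 \<odot> (y2 \<odot> (a \<curlyvee> y1)) - y3 \<odot> (y1 \<odot> (a \<curlyvee> y2)) + y3 \<odot> (b \<odot> c)"
    by (simp add: bracket_x triple_def b_def circ_ast_left circ_additive)
  have "bracket x1 x2 (b \<star> y3)
    = (bracket (a \<star> y1) y2 y3 + bracket y1 (a \<star> y2) y3)
      + bracket y1 y2 (a \<star> y3)
      + (triple (bracket x1 x2 y1) y2 y3 - triple (bracket x1 x2 y2) y1 y3)
      + b \<odot> bracket x1 x2 y3 - a \<odot> bracket y1 y2 y3"
    unfolding inner triples
    unfolding bracket_x bracket_y outer nested circ_ast_left[of b y3] circ_ast_left[of a y3]
      circ_additive(4)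
    by (simp add: algebra_simps)
  then show ?thesis
    by (simp add: a_def b_def add.assoc add_diff_eq)
qed

theorem ns_lie_triple_system_triple_bracket: "ns_lie_triple_system scale triple bracket"
proof
  show "trilinear_op scale triple" "trilinear_op scale bracket"
    by (rule triple_trilinear bracket_trilinear)+
  fix x1 x2 y1 y2 y3
  show "bracket y1 y2 y3 = - bracket y2 y1 y3"
    by (rule bracket_skew)
  show "bracket y1 y2 y3 + bracket y2 y3 y1 + bracket y3 y1 y2 = 0"
    by (rule bracket_cyclic)
qed (unfold triple_dbl_triple_bracket triple_star_triple,
    (rule triple_Lie_triple_product circ_triple bracket_Lie_triple_product)+)

end

theorem theorem6p10:
  fixes scale :: "'k::field_char_0 \<Rightarrow> 'a::ab_group_add \<Rightarrow> 'a"
    and circ cv :: "'a \<Rightarrow> 'a \<Rightarrow> 'a"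
    and T B :: "'a \<Rightarrow> 'a \<Rightarrow> 'a \<Rightarrow> 'a"
  assumes "ns_lie_algebra scale circ cv"
    and "\<And>x y z. T x y z = circ z (circ y x)"
    and "\<And>x y z. B x y z = cv (ns_ast circ cv x y) z - circ z (cv x y)"
  shows "ns_lie_triple_system scale T B \<and>
    (\<forall>x y z. triple_dbl T B x y z = ns_ast circ cv (ns_ast circ cv x y) z)"
proof -
  interpret ns_lie_algebra scale circ cv by (rule assms(1))
  have "T = triple" "B = bracket"
    by (simp_all add: fun_eq_iff assms(2,3) triple_def bracket_def)
  then show ?thesis
    using ns_lie_triple_system_triple_bracket triple_dbl_triple_bracket by simp
qed

end
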